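(* Assume (A1)-(A4) of the context. If $x^*\in\mathcal L(F^0)$ is a strict saddle point of $F$, then $(x^*,\epsilon^* )$ with $\epsilon^*=0$ is an unstable fixed point of $T$. Moreover, for $\alpha<\beta/\rho$, $DT(x^*,0)$ is invertible.
   Context: Let $f:\mathbb R^n\to\mathbb R$ be twice continuously differentiable, $\lambda>0$, $F(x)=f(x)+\lambda\sum_{i=1}^n r(|x_i|)$. (A1) $r:[0,\infty)\to\mathbb R$ is continuous and concave, $r(0)=0$, $C^2$ on $(0,\infty)$, $r'(t)\ge0$ for all $t>0$, and $r'(0^+):=\lim_{t\to0^+}r'(t)\in(0,\infty]$. (A2) Every $x$ with $0\in\partial F(x)$ satisfies $0\in\mathrm{rint}\,\partial F(x)$ ($\partial F$ the regular subdifferential, $\mathrm{rint}$ the relative interior). (A3) With $F(x,\epsilon)=f(x)+\lambda\sum_i r\big(\sqrt{x_i^2+\epsilon_i^2}\big)$ and $F^0=F(x^0,\epsilon^0)$ for a given initial point, $\mathcal L(F^0)=\{x:F(x)\le F^0\}$ is bounded. (A4) $\lim_{z\to0^+}r'(z)=\infty$ and $\lim_{z\to0^+}z\,r''(z)/r'(z)^2=0$. $\mathcal I(x)=\{i:x_i\ne0\}$, $\mathcal J(x)=\{i:x_i=0\}$; $\nabla^2_{\mathcal I^*\mathcal I^*}F(x^* )$, with $\mathcal I^*=\mathcal I(x^* )$, is the Hessian of $F$ at $x^*$ with respect to the nonzero coordinates. A point $x^*$ is stationary if $\nabla_i f(x^* )=-\lambda\,\mathrm{sign}(x_i^* )r'(|x_i^*|)$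 for $i\in\mathcal I(x^* )$ and $\nabla_i f(x^* )\in(-\lambda r'(0^+),\lambda r'(0^+))$ for $i\in\mathcal J(x^* )$. A stationary point $x^*$ is a strict saddle point if $d^T\nabla^2_{\mathcal I^*\mathcal I^*}F(x^* )d<0$ for some $d\in\mathbb R^{|\mathcal I^*|}$. The constant $\rho>0$ satisfies $\|\nabla^2_{\mathcal I^*\mathcal I^*}F(x^* )\|\le\rho$ (spectral norm) for every stationary point $x^*\in\mathcal L(F^0)$. Let $\beta>0$, $\alpha,\mu\in(0,1)$. For $(x,\epsilon)\in\mathbb R^n\times\mathbb R^n$ set $u(x_i,\epsilon_i)=\dfrac{r'(\sqrt{x_i^2+\epsilon_i^2})}{2\sqrt{x_i^2+\epsilon_i^2}}$ if $(x_i,\epsilon_i)\ne(0,0)$, $u(0,0)=\infty$; $S^x_i(x,\epsilon)=\big(1+\frac{2\lambda}\beta u(x_i,\epsilon_i)\big)^{-1}\big(x_i-\frac1\beta\nabla_i f(x)\big)$, read as $0$ if $u(x_i,\epsilon_i)=\infty$; and $T(x,\epsilon)=((1-\alpha)x+\alpha S^x(x,\epsilon),(1-\alpha(1-\mu))\epsilon)$, which is a $C^1$ map with Jacobian $DT$. A fixed point of $T$ is unstable if $DT$ at that point has at least one eigenvalue of magnitude strictly larger than $1$. *)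

theory Defs
  imports "HOL-Analysis.Analysis"
begin

section \<open>Calculus notions\<close>

definition C2_fun :: "(real^'n \<Rightarrow> real) \<Rightarrow> bool" where
  "C2_fun f \<longleftrightarrow> (\<exists>(g :: real^'n \<Rightarrow> real^'n) (H :: real^'n \<Rightarrow> real^'n^'n).
     (\<forall>x. (f has_derivative (\<lambda>h. g x \<bullet> h)) (at x)) \<and>
     (\<forall>x. (g has_derivative (\<lambda>h. H x *v h)) (at x)) \<and>
     continuous_on UNIV H)"

(* One-variable derivative along a coordinate axis.  The regularised objective need not be
   Frechet differentiable at points with zero coordinates, but its partial derivatives with
   respect to nonzero coordinates exist there. *)
definition partial :: "'n \<Rightarrow> (real^'n \<Rightarrow> real) \<Rightarrow> real^'n \<Rightarrow> real" where
  "partial i g x = deriv (\<lambda>t. g (x + t *\<^sub>R axis i 1)) 0"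

definition reg_subdiff :: "('a::euclidean_space \<Rightarrow> real) \<Rightarrow> 'a \<Rightarrow> 'a set" where
  "reg_subdiff F x =
     {v. Liminf (at x) (\<lambda>y. ereal ((F y - F x - v \<bullet> (y - x)) / norm (y - x))) \<ge> 0}"

(* The complexification of a real vector space V is V \<times> V, where (p, q) stands for p + i q. *)
definition complex_scale :: "complex \<Rightarrow> 'a::real_vector \<times> 'a \<Rightarrow> 'a \<times> 'a" where
  "complex_scale c v = (Re c *\<^sub>R fst v - Im c *\<^sub>R snd v, Im c *\<^sub>R fst v + Re c *\<^sub>R snd v)"

(* Complex eigenvalues of a real linear map: those of its complexification map_prod L L. *)
definition eigval :: "('a::real_vector \<Rightarrow> 'a) \<Rightarrow> complex \<Rightarrow> bool" where
  "eigval L c \<longleftrightarrow> (\<exists>v. v \<noteq> 0 \<and> map_prod L L v = complex_scale c v)"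

definition unstable_fixed_point :: "('a::real_normed_vector \<Rightarrow> 'a) \<Rightarrow> 'a \<Rightarrow> bool" where
  "unstable_fixed_point T z \<longleftrightarrow> T z = z \<and> T differentiable (at z) \<and>
     (\<exists>c. eigval (frechet_derivative T (at z)) c \<and> cmod c > 1)"


section \<open>The regularised problem\<close>

definition obj :: "(real^'n \<Rightarrow> real) \<Rightarrow> real \<Rightarrow> (real \<Rightarrow> real) \<Rightarrow> real^'n \<Rightarrow> real" where
  "obj f lam r x = f x + lam * (\<Sum>i\<in>UNIV. r \<bar>x $ i\<bar>)"

definition obj_smooth ::
  "(real^'n \<Rightarrow> real) \<Rightarrow> real \<Rightarrow> (real \<Rightarrow> real) \<Rightarrow> real^'n \<Rightarrow> real^'n \<Rightarrow> real" where
  "obj_smooth f lam r x e = f x + lam * (\<Sum>i\<in>UNIV. r (sqrt ((x $ i)\<^sup>2 + (e $ i)\<^sup>2)))"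

definition level_set :: "(real^'n \<Rightarrow> real) \<Rightarrow> real \<Rightarrow> (real^'n) set" where
  "level_set F c = {x. F x \<le> c}"

definition rprime0 :: "(real \<Rightarrow> real) \<Rightarrow> ereal" where
  "rprime0 r = Lim (at_right 0) (\<lambda>t. ereal (deriv r t))"

(* r represents a function on [0,\<infinity>); its values at negative arguments are irrelevant. *)
definition A1 :: "(real \<Rightarrow> real) \<Rightarrow> bool" where
  "A1 r \<longleftrightarrow> continuous_on {0..} r \<and> concave_on {0..} r \<and> r 0 = 0 \<and>
     (\<forall>t>0. r differentiable (at t)) \<and>
     (\<forall>t>0. deriv r differentiable (at t)) \<and>
     continuous_on {0<..} (deriv (deriv r)) \<and>
     (\<forall>t>0. deriv r t \<ge> 0) \<and>
     ((\<lambda>t. ereal (deriv r t)) \<longlongrightarrow> rprime0 r) (at_right 0) \<and> rprime0 r > 0"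

definition A2 :: "(real^'n \<Rightarrow> real) \<Rightarrow> bool" where
  "A2 F \<longleftrightarrow> (\<forall>x. 0 \<in> reg_subdiff F x \<longrightarrow> 0 \<in> rel_interior (reg_subdiff F x))"

definition A3 :: "(real^'n \<Rightarrow> real) \<Rightarrow> real \<Rightarrow> bool" where
  "A3 F F0 \<longleftrightarrow> bounded (level_set F F0)"

definition A4 :: "(real \<Rightarrow> real) \<Rightarrow> bool" where
  "A4 r \<longleftrightarrow> filterlim (deriv r) at_top (at_right 0) \<and>
     ((\<lambda>z. z * deriv (deriv r) z / (deriv r z)\<^sup>2) \<longlongrightarrow> 0) (at_right 0)"

definition nz :: "real^'n \<Rightarrow> 'n set" where
  "nz x = {i. x $ i \<noteq> 0}"

definition zr :: "real^'n \<Rightarrow> 'n set" where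
  "zr x = {i. x $ i = 0}"

definition stationary :: "(real^'n \<Rightarrow> real) \<Rightarrow> real \<Rightarrow> (real \<Rightarrow> real) \<Rightarrow> real^'n \<Rightarrow> bool" where
  "stationary f lam r x \<longleftrightarrow>
     (\<forall>i\<in>nz x. partial i f x = - lam * sgn (x $ i) * deriv r \<bar>x $ i\<bar>) \<and>
     (\<forall>i\<in>zr x. - (ereal lam * rprime0 r) < ereal (partial i f x) \<and>
                ereal (partial i f x) < ereal lam * rprime0 r)"

(* Vectors indexed by the nonzero coordinates of x are identified with vectors of the full
   space supported there, and the corresponding Hessian block is padded with zeros.  The
   padding changes neither the quadratic form on such vectors nor the spectral norm. *)
definition nz_space :: "real^'n \<Rightarrow> (real^'n) set" where
  "nz_space x = {d. \<forall>i. i \<notin> nz x \<longrightarrow> d $ i = 0}"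

definition nz_hessian :: "(real^'n \<Rightarrow> real) \<Rightarrow> real^'n \<Rightarrow> real^'n^'n" where
  "nz_hessian F x =
     (\<chi> i j. if i \<in> nz x \<and> j \<in> nz x then partial i (partial j F) x else 0)"

definition spectral_norm :: "real^'n^'n \<Rightarrow> real" where
  "spectral_norm A = onorm (\<lambda>v. A *v v)"

definition strict_saddle :: "(real^'n \<Rightarrow> real) \<Rightarrow> real \<Rightarrow> (real \<Rightarrow> real) \<Rightarrow> real^'n \<Rightarrow> bool" where
  "strict_saddle f lam r x \<longleftrightarrow> stationary f lam r x \<and>
     (\<exists>d\<in>nz_space x. d \<bullet> (nz_hessian (obj f lam r) x *v d) < 0)"


section \<open>The iteration map\<close>

definition weight :: "(real \<Rightarrow> real) \<Rightarrow> real \<Rightarrow> real \<Rightarrow> ereal" where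
  "weight r a e = (if (a, e) = (0, 0) then \<infinity>
     else ereal (deriv r (sqrt (a\<^sup>2 + e\<^sup>2)) / (2 * sqrt (a\<^sup>2 + e\<^sup>2))))"

definition Sx :: "(real^'n \<Rightarrow> real) \<Rightarrow> real \<Rightarrow> (real \<Rightarrow> real) \<Rightarrow> real \<Rightarrow>
    real^'n \<Rightarrow> real^'n \<Rightarrow> real^'n" where
  "Sx f lam r bet x e = (\<chi> i.
     if weight r (x $ i) (e $ i) = \<infinity> then 0
     else inverse (1 + 2 * lam / bet * real_of_ereal (weight r (x $ i) (e $ i)))
          * (x $ i - 1 / bet * partial i f x))"

definition Tmap :: "(real^'n \<Rightarrow> real) \<Rightarrow> real \<Rightarrow> (real \<Rightarrow> real) \<Rightarrow> real \<Rightarrow> real \<Rightarrow> real \<Rightarrow>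
    (real^'n) \<times> (real^'n) \<Rightarrow> (real^'n) \<times> (real^'n)" where
  "Tmap f lam r bet alp mu = (\<lambda>(x, e).
     ((1 - alp) *\<^sub>R x + alp *\<^sub>R Sx f lam r bet x e, (1 - alp * (1 - mu)) *\<^sub>R e))"

end

theory Submission
  imports Defs
begin

text \<open>
  Write $c_i = 1 + \frac{\lambda}{\beta} r'(|x^*_i|) / |x^*_i|$ for $i \in \mathcal I^*$ and let $A$ be the
  Hessian block of $F$ at $x^*$. Stationarity turns the derivative of $S^x_i$ at $(x^*, 0)$ into
  $h_i - (\nabla^2 f\, h + \lambda r'' h)_i / (\beta c_i)$, while for $i \in \mathcal J^*$ it vanishes, because
  $S^x_i(x, \epsilon) = O(s / r'(s))$ with $s = \sqrt{x_i^2 + \epsilon_i^2}$ and $r'(0^+) = \infty$.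
  So on vectors supported on $\mathcal I^*$ the Jacobian acts as $I - \frac{\alpha}{\beta} C^{-1} A$, and
  modulo this invariant block it is multiplication by numbers in $(0, 1)$.
  Since $C^{-1/2} A C^{-1/2}$ is symmetric and, at a strict saddle, has a negative eigenvalue $\kappa$,
  the Jacobian has the eigenvalue $1 - \frac{\alpha}{\beta}\kappa > 1$. A kernel vector $h$ satisfies
  $\beta |h|^2 \le \beta\, h \cdot C h = \alpha\, h \cdot A h \le \alpha\rho |h|^2$, as $c_i \ge 1$, so $h = 0$ when
  $\alpha\rho < \beta$.
\<close>

section \<open>Symmetric second derivatives and self-adjoint maps\<close>

lemma second_derivative_symmetric:
  fixes f :: "'a::real_inner \<Rightarrow> real"
  assumes f: "\<And>y. (f has_derivative (\<lambda>h. g y \<bullet> h)) (at y)"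
    and g: "(g has_derivative L) (at x)"
  shows "L u \<bullet> v = L v \<bullet> u"
proof -
  \<comment> \<open>\<open>D u v t / t\<^sup>2\<close> tends to \<open>L v \<bullet> u\<close> by the mean value theorem, and \<open>D\<close> is symmetric in \<open>u\<close>, \<open>v\<close>.\<close>
  define D where "D u v t = f (x + t *\<^sub>R u + t *\<^sub>R v) - f (x + t *\<^sub>R u) - f (x + t *\<^sub>R v) + f x"
    for u v and t :: real
  have lin: "linear L"
    using g has_derivative_linear by blast
  have key: "\<exists>d>0. \<forall>t. 0 < t \<and> t < d \<longrightarrow> \<bar>D u v t - t\<^sup>2 * (L v \<bullet> u)\<bar> \<le> e * t\<^sup>2"
    if "e > 0" for e :: real and u v
  proof -
    \<comment> \<open>\<open>K\<close> collects the error below: displacements of size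
      \<open>t * (norm u + norm v)\<close> and \<open>t * norm u\<close> are added, and the mean
      value step multiplies by \<open>t * norm u\<close>. Dividing by \<open>K + 1\<close> covers
      the case \<open>K = 0\<close>.\<close>
    define K where "K = (2 * norm u + norm v) * norm u"
    have "K \<ge> 0" by (simp add: K_def)
    define e' where "e' = e / (K + 1)"
    have "e' > 0" using \<open>e > 0\<close> \<open>K \<ge> 0\<close> by (simp add: e'_def)
    have "e' * K \<le> e"
      using \<open>e > 0\<close> \<open>K \<ge> 0\<close> by (simp add: e'_def field_simps)
    obtain d where "d > 0"
      and d: "\<And>y. norm (y - x) < d \<Longrightarrow> norm (g y - g x - L (y - x)) \<le> e' * norm (y - x)"
      using g \<open>e' > 0\<close> unfolding has_derivative_at_alt by blast
    \<comment> \<open>For \<open>t < d'\<close> every displacement from \<open>x\<close> used below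
      is shorter than \<open>d\<close>.\<close>
    define d' where "d' = d / (norm u + norm v + 1)"
    have "d' > 0" using \<open>d > 0\<close> by (simp add: d'_def add_nonneg_pos)
    have "\<bar>D u v t - t\<^sup>2 * (L v \<bullet> u)\<bar> \<le> e * t\<^sup>2" if t: "0 < t" "t < d'" for t
    proof -
      have "t * (norm u + norm v + 1) < d"
        using t by (simp add: d'_def pos_less_divide_eq add_nonneg_pos)
      then have td: "t * norm u + t * norm v < d"
        using t by (simp add: algebra_simps)
      \<comment> \<open>\<open>D u v t\<close> is the increment of \<open>\<phi>\<close> over
        \<open>[0, t]\<close>, so one mean value step in direction \<open>u\<close> turns it into a
        difference of two gradients.\<close>
      define \<phi> where "\<phi> s = f (x + s *\<^sub>R u + t *\<^sub>R v) - f (x + s *\<^sub>R u)" for s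
      have "(\<phi> has_real_derivative (g (x + s *\<^sub>R u + t *\<^sub>R v) - g (x + s *\<^sub>R u)) \<bullet> u) (at s)" for s
        unfolding \<phi>_def has_field_derivative_def
        by (rule has_derivative_eq_rhs,
            rule has_derivative_diff[OF has_derivative_compose[OF _ f] has_derivative_compose[OF _ f]])
          (auto intro!: derivative_eq_intros simp: inner_diff_left algebra_simps)
      then obtain s where s: "0 < s" "s < t"
        and mvt: "\<phi> t - \<phi> 0 = t * ((g (x + s *\<^sub>R u + t *\<^sub>R v) - g (x + s *\<^sub>R u)) \<bullet> u)"
        using MVT2[of 0 t \<phi> "\<lambda>s. (g (x + s *\<^sub>R u + t *\<^sub>R v) - g (x + s *\<^sub>R u)) \<bullet> u"] t
        by auto
      define y z where "y = x + s *\<^sub>R u + t *\<^sub>R v" and "z = x + s *\<^sub>R u"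
      have su: "s * norm u \<le> t * norm u"
        using s by (simp add: mult_right_mono)
      have yx: "norm (y - x) \<le> t * norm u + t * norm v"
        using norm_triangle_ineq[of "s *\<^sub>R u" "t *\<^sub>R v"] s su by (simp add: y_def)
      have zx: "norm (z - x) \<le> t * norm u"
        using s su by (simp add: z_def)
      have "norm (z - x) < d"
        using zx td t by (smt (verit) mult_nonneg_nonneg norm_ge_zero)
      have "norm (g y - g x - L (y - x)) \<le> e' * (t * norm u + t * norm v)"
        using d[of y] yx td \<open>e' > 0\<close> by (smt (verit) mult_left_mono)
      moreover have "norm (g z - g x - L (z - x)) \<le> e' * (t * norm u)"
        using d[of z] zx \<open>norm (z - x) < d\<close> \<open>e' > 0\<close> by (smt (verit) mult_left_mono)
      ultimately have "norm ((g y - g x - L (y - x)) - (g z - g x - L (z - x)))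
          \<le> e' * (t * norm u + t * norm v) + e' * (t * norm u)"
        by (smt (verit) norm_triangle_ineq4)
      \<comment> \<open>Both gradients are expanded at \<open>x\<close>, the only point where
        \<open>g\<close> is assumed differentiable. The unknown \<open>s\<close> drops out of the
        difference of the linear terms.\<close>
      moreover have "L (y - x) - L (z - x) = t *\<^sub>R L v"
        unfolding linear_diff[OF lin, symmetric] y_def z_def by (simp add: linear_cmul[OF lin])
      ultimately have n: "norm (g y - g z - t *\<^sub>R L v) \<le> e' * (t * norm u + t * norm v) + e' * (t * norm u)"
        by (simp add: algebra_simps)
      have "\<phi> t - \<phi> 0 - t\<^sup>2 * (L v \<bullet> u) = t * ((g y - g z - t *\<^sub>R L v) \<bullet> u)"
        unfolding mvt y_def z_def by (simp add: inner_diff_left power2_eq_square algebra_simps)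
      then have "\<bar>\<phi> t - \<phi> 0 - t\<^sup>2 * (L v \<bullet> u)\<bar> = t * \<bar>(g y - g z - t *\<^sub>R L v) \<bullet> u\<bar>"
        using t by (simp add: abs_mult)
      also have "\<dots> \<le> t * (norm (g y - g z - t *\<^sub>R L v) * norm u)"
        using t by (intro mult_left_mono Cauchy_Schwarz_ineq2) auto
      also have "\<dots> \<le> t * ((e' * (t * norm u + t * norm v) + e' * (t * norm u)) * norm u)"
        using t n by (intro mult_left_mono mult_right_mono) auto
      also have "\<dots> = (e' * K) * t\<^sup>2"
        by (simp add: K_def power2_eq_square algebra_simps)
      also have "\<dots> \<le> e * t\<^sup>2"
        using \<open>e' * K \<le> e\<close> by (intro mult_right_mono) auto
      finally show ?thesis
        by (simp add: \<phi>_def D_def algebra_simps)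
    qed
    then show ?thesis using \<open>d' > 0\<close> by blast
  qed
  show ?thesis
  proof (rule ccontr)
    assume ne: "L u \<bullet> v \<noteq> L v \<bullet> u"
    \<comment> \<open>The two estimates together bound the gap by \<open>2 * e\<close>; a third of
      the gap therefore gives a contradiction.\<close>
    define e where "e = \<bar>L u \<bullet> v - L v \<bullet> u\<bar> / 3"
    have "e > 0" using ne by (simp add: e_def)
    obtain d1 where "d1 > 0" and d1: "\<And>t. 0 < t \<and> t < d1 \<Longrightarrow> \<bar>D u v t - t\<^sup>2 * (L v \<bullet> u)\<bar> \<le> e * t\<^sup>2"
      using key[OF \<open>e > 0\<close>] by blast
    obtain d2 where "d2 > 0" and d2: "\<And>t. 0 < t \<and> t < d2 \<Longrightarrow> \<bar>D v u t - t\<^sup>2 * (L u \<bullet> v)\<bar> \<le> e * t\<^sup>2"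
      using key[OF \<open>e > 0\<close>] by blast
    define t where "t = min d1 d2 / 2"
    have t: "0 < t" "t < d1" "t < d2" using \<open>d1 > 0\<close> \<open>d2 > 0\<close> by (auto simp: t_def)
    have "D u v t = D v u t" by (simp add: D_def algebra_simps)
    then have "\<bar>t\<^sup>2 * (L u \<bullet> v) - t\<^sup>2 * (L v \<bullet> u)\<bar> \<le> 2 * e * t\<^sup>2"
      using d1[of t] d2[of t] t by auto
    moreover have "\<bar>t\<^sup>2 * (L u \<bullet> v) - t\<^sup>2 * (L v \<bullet> u)\<bar> = t\<^sup>2 * \<bar>L u \<bullet> v - L v \<bullet> u\<bar>"
      unfolding right_diff_distrib[symmetric] abs_mult by simp
    ultimately have "t\<^sup>2 * \<bar>L u \<bullet> v - L v \<bullet> u\<bar> \<le> t\<^sup>2 * (2 * e)"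
      by (simp only: mult.commute)
    then have "\<bar>L u \<bullet> v - L v \<bullet> u\<bar> \<le> 2 * e" using t by simp
    then show False using \<open>e > 0\<close> by (simp add: e_def)
  qed
qed

text \<open>A minimiser \<open>v\<close> of the quadratic form on the unit sphere is an eigenvector:
  otherwise moving from \<open>v\<close> against the residual \<open>L v - k *\<^sub>R v\<close>
  would push the Rayleigh quotient below its minimum \<open>k\<close>. The vector \<open>d\<close>
  forces \<open>k < 0\<close>.\<close>

lemma selfadjoint_negative_eigenvalue:
  fixes L :: "'a::euclidean_space \<Rightarrow> 'a"
  assumes lin: "linear L" and adj: "\<And>x y. L x \<bullet> y = x \<bullet> L y" and d: "d \<bullet> L d < 0"
  obtains k v where "k < 0" "v \<noteq> 0" "L v = k *\<^sub>R v"
proof -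
  have "d \<noteq> 0" using d by auto
  have "continuous_on (sphere 0 1) (\<lambda>v. v \<bullet> L v)"
    by (intro continuous_intros linear_continuous_on linear_conv_bounded_linear[THEN iffD1] lin)
  moreover have "d /\<^sub>R norm d \<in> sphere 0 1" using \<open>d \<noteq> 0\<close> by simp
  ultimately obtain v where v: "v \<in> sphere 0 1"
    and min: "\<And>w. w \<in> sphere 0 1 \<Longrightarrow> v \<bullet> L v \<le> w \<bullet> L w"
    using continuous_attains_inf[of "sphere 0 1" "\<lambda>v. v \<bullet> L v"] by auto
  define k where "k = v \<bullet> L v"
  have ray: "k * (w \<bullet> w) \<le> w \<bullet> L w" for w
  proof (cases "w = 0")
    case False
    then have "k \<le> (w /\<^sub>R norm w) \<bullet> L (w /\<^sub>R norm w)"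
      unfolding k_def by (intro min) simp
    also have "\<dots> = (w \<bullet> L w) / (w \<bullet> w)"
      by (simp add: linear_cmul[OF lin] power2_eq_square divide_simps flip: power2_norm_eq_inner)
    finally show ?thesis using False by (simp add: field_simps)
  qed (simp add: linear_0[OF lin])
  have "k * (d \<bullet> d) < 0" using ray[of d] d by simp
  then have "k < 0" using inner_ge_zero[of d] by (simp add: mult_less_0_iff)
  define w where "w = L v - k *\<^sub>R v"
  define a b where "a = w \<bullet> w" and "b = w \<bullet> L w - k * (w \<bullet> w)"
  have vv: "v \<bullet> v = 1" using v by (simp flip: power2_norm_eq_inner)
  have "b \<ge> 0" using ray[of w] by (simp add: b_def)
  \<comment> \<open>The term without \<open>t\<close> vanishes because \<open>v\<close> attains the
    bound in \<open>ray\<close>, and self-adjointness merges the two cross terms.\<close>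
  have quad: "0 \<le> 2 * t * a + t\<^sup>2 * b" for t
  proof -
    have "0 \<le> (v + t *\<^sub>R w) \<bullet> L (v + t *\<^sub>R w) - k * ((v + t *\<^sub>R w) \<bullet> (v + t *\<^sub>R w))"
      using ray by simp
    also have "\<dots> = 2 * t * (w \<bullet> L v - k * (w \<bullet> v)) + t\<^sup>2 * b"
      using adj[of v w] vv k_def
      by (simp add: linear_add[OF lin] linear_cmul[OF lin] inner_add_left inner_add_right b_def
          inner_commute power2_eq_square algebra_simps)
    also have "w \<bullet> L v - k * (w \<bullet> v) = a"
      by (simp add: a_def w_def inner_diff_right)
    finally show ?thesis .
  qed
  have "a = 0"
  proof (rule ccontr)
    assume "a \<noteq> 0"
    \<comment> \<open>With this \<open>t\<close> the quadratic at \<open>- t\<close> equals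
      \<open>- (t\<^sup>2 * (b + 2))\<close>, which is negative; \<open>b + 1\<close> rather than
      \<open>b\<close> allows \<open>b = 0\<close>.\<close>
    define t where "t = a / (b + 1)"
    have a: "a = t * (b + 1)" and "t \<noteq> 0"
      using \<open>a \<noteq> 0\<close> \<open>b \<ge> 0\<close> by (simp_all add: t_def)
    have "0 \<le> 2 * (- t) * a + (- t)\<^sup>2 * b" by (rule quad)
    also have "\<dots> = - (t\<^sup>2 * (b + 2))"
      by (simp add: a power2_eq_square algebra_simps)
    finally show False
      using \<open>t \<noteq> 0\<close> \<open>b \<ge> 0\<close> by (simp add: mult_le_0_iff)
  qed
  then have "L v = k *\<^sub>R v" by (simp add: a_def w_def)
  moreover have "v \<noteq> 0" using vv by auto
  ultimately show ?thesis using that \<open>k < 0\<close> by blast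
qed

section \<open>Partial derivatives of the objective\<close>

lemma partial_eq:
  assumes "(f has_derivative L) (at x)"
  shows "partial i f x = L (axis i 1)"
proof -
  have "((\<lambda>t. f (x + t *\<^sub>R axis i 1)) has_derivative (\<lambda>t. L (t *\<^sub>R axis i 1))) (at 0)"
    by (rule has_derivative_compose[of "\<lambda>t. x + t *\<^sub>R axis i 1"])
      (auto intro!: derivative_eq_intros simp: assms)
  then have "((\<lambda>t. f (x + t *\<^sub>R axis i 1)) has_real_derivative L (axis i 1)) (at 0)"
    unfolding has_field_derivative_def
    using has_derivative_linear[OF assms] by (simp add: linear_cmul mult_commute_abs)
  then show ?thesis
    unfolding partial_def by (rule DERIV_imp_deriv)
qed

lemma eventually_sgn_eq:
  "a \<noteq> 0 \<Longrightarrow> \<forall>\<^sub>F t in nhds (a::real). sgn t = sgn a"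
proof (cases "a > 0")
  case True
  then have "\<forall>\<^sub>F t in nhds a. t \<in> {0<..}" by (intro eventually_nhds_in_open) auto
  then show ?thesis by eventually_elim (use True in auto)
next
  case False
  assume "a \<noteq> 0"
  then have "\<forall>\<^sub>F t in nhds a. t \<in> {..<0}" using False by (intro eventually_nhds_in_open) auto
  then show ?thesis by eventually_elim (use False \<open>a \<noteq> 0\<close> in auto)
qed

text \<open>The sign is constant near \<open>a\<close>, so the absolute value is there the linear
  map \<open>t \<mapsto> sgn a * t\<close>.\<close>

lemma has_real_derivative_compose_abs:
  fixes a :: real
  assumes "(r has_real_derivative D) (at \<bar>a\<bar>)" and "a \<noteq> 0"
  shows "((\<lambda>t. r \<bar>t\<bar>) has_real_derivative sgn a * D) (at a)"
proof -
  have "((\<lambda>t. r (sgn a * t)) has_real_derivative D * sgn a) (at a)"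
    by (rule DERIV_chain2[of r])
      (use assms in \<open>auto intro!: derivative_eq_intros simp: abs_real_def sgn_real_def\<close>)
  moreover have "\<forall>\<^sub>F t in nhds a. r (sgn a * t) = r \<bar>t\<bar>"
    using eventually_sgn_eq[OF \<open>a \<noteq> 0\<close>] by eventually_elim (auto simp: abs_real_def sgn_real_def split: if_splits)
  ultimately show ?thesis
    using DERIV_cong_ev by (fastforce simp: mult.commute)
qed

text \<open>Along axis \<open>j\<close> all penalty terms but the \<open>j\<close>-th are constant,
  so other coordinates may be zero although the objective can fail to be differentiable
  there.\<close>

lemma partial_obj:
  assumes f: "(f has_derivative (\<lambda>h. g \<bullet> h)) (at x)"
    and r: "r differentiable (at \<bar>x $ j\<bar>)" and "x $ j \<noteq> 0"
  shows "partial j (obj f lam r) x = g $ j + lam * (sgn (x $ j) * deriv r \<bar>x $ j\<bar>)"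
proof -
  have r': "(r has_real_derivative deriv r \<bar>x $ j\<bar>) (at \<bar>x $ j\<bar>)"
    using r by (simp add: DERIV_deriv_iff_real_differentiable)
  have "((\<lambda>t. r \<bar>(x + t *\<^sub>R axis j 1) $ i\<bar>) has_real_derivative
      (if i = j then sgn (x $ j) * deriv r \<bar>x $ j\<bar> else 0)) (at 0)" for i
  proof (cases "i = j")
    case True
    have "((\<lambda>t. r \<bar>x $ j + t\<bar>) has_real_derivative sgn (x $ j) * deriv r \<bar>x $ j\<bar>) (at 0)"
      using DERIV_shift[of "\<lambda>t. r \<bar>t\<bar>" _ 0 "x $ j"] has_real_derivative_compose_abs[OF r' \<open>x $ j \<noteq> 0\<close>]
      by (simp add: add.commute)
    then show ?thesis using True by simp
  qed (simp add: axis_def)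
  then have "((\<lambda>t. \<Sum>i\<in>UNIV. r \<bar>(x + t *\<^sub>R axis j 1) $ i\<bar>) has_real_derivative
      (\<Sum>i\<in>UNIV. if i = j then sgn (x $ j) * deriv r \<bar>x $ j\<bar> else 0)) (at 0)"
    by (rule DERIV_sum)
  then have s: "((\<lambda>t. \<Sum>i\<in>UNIV. r \<bar>(x + t *\<^sub>R axis j 1) $ i\<bar>) has_real_derivative
      sgn (x $ j) * deriv r \<bar>x $ j\<bar>) (at 0)"
    by simp
  have "((\<lambda>t. f (x + t *\<^sub>R axis j 1)) has_derivative (\<lambda>t. g \<bullet> (t *\<^sub>R axis j 1))) (at 0)"
    by (rule has_derivative_compose[of "\<lambda>t. x + t *\<^sub>R axis j 1"])
      (auto intro!: derivative_eq_intros simp: f)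
  then have "((\<lambda>t. f (x + t *\<^sub>R axis j 1)) has_real_derivative g $ j) (at 0)"
    unfolding has_field_derivative_def by (simp add: inner_axis mult_commute_abs)
  from DERIV_add[OF this DERIV_cmult[OF s, of lam]]
  show ?thesis
    unfolding partial_def obj_def by (rule DERIV_imp_deriv)
qed

text \<open>The closed form of the inner partial derivative holds where coordinate \<open>j\<close>
  is nonzero, hence along the whole axis \<open>i\<close> near \<open>x\<close>, with the sign of
  coordinate \<open>j\<close> frozen. Differentiating that form gives the claim.\<close>

lemma partial_partial_obj:
  assumes f: "\<And>y. (f has_derivative (\<lambda>h. g y \<bullet> h)) (at y)"
    and g: "(g has_derivative L) (at x)"
    and r: "\<And>t. t > 0 \<Longrightarrow> r differentiable (at t)" "\<And>t. t > 0 \<Longrightarrow> deriv r differentiable (at t)"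
    and xj: "x $ j \<noteq> 0"
  shows "partial i (partial j (obj f lam r)) x =
    L (axis i 1) $ j + (if i = j then lam * deriv (deriv r) \<bar>x $ j\<bar> else 0)"
proof -
  let ?y = "\<lambda>t. x + t *\<^sub>R axis i 1"
  have "((\<lambda>t. ?y t $ j) \<longlongrightarrow> ?y 0 $ j) (nhds 0)"
    by (intro tendsto_intros filterlim_ident)
  then have "filterlim (\<lambda>t. ?y t $ j) (nhds (x $ j)) (nhds 0)"
    by simp
  then have sg: "\<forall>\<^sub>F t in nhds 0. sgn (?y t $ j) = sgn (x $ j)"
    using eventually_compose_filterlim[OF eventually_sgn_eq[OF xj]] by blast
  have ev: "\<forall>\<^sub>F t in nhds 0. partial j (obj f lam r) (?y t) =
      g (?y t) $ j + lam * (sgn (x $ j) * deriv r \<bar>?y t $ j\<bar>)"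
    using sg
  proof eventually_elim
    case (elim t)
    then have "?y t $ j \<noteq> 0" using xj by (metis sgn_zero_iff)
    then show ?case
      using partial_obj[OF f r(1), of "?y t" j] elim by simp
  qed
  have d1: "((\<lambda>t. g (?y t) $ j) has_real_derivative L (axis i 1) $ j) (at 0)"
  proof -
    have "((\<lambda>t. g (?y t)) has_derivative (\<lambda>t. L (t *\<^sub>R axis i 1))) (at 0)"
      by (rule has_derivative_compose[of ?y])
        (auto intro!: derivative_eq_intros simp: g)
    then have "((\<lambda>t. g (?y t) $ j) has_derivative (\<lambda>t. L (t *\<^sub>R axis i 1) $ j)) (at 0)"
      by (rule bounded_linear.has_derivative[OF bounded_linear_vec_nth])
    then show ?thesis
      unfolding has_field_derivative_def
      using has_derivative_linear[OF g] by (simp add: linear_cmul mult_commute_abs)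
  qed
  \<comment> \<open>Differentiating the absolute value produces a second factor
    \<open>sgn (x $ j)\<close>, and the two signs multiply to 1.\<close>
  have d2: "((\<lambda>t. sgn (x $ j) * deriv r \<bar>?y t $ j\<bar>) has_real_derivative
      (if i = j then deriv (deriv r) \<bar>x $ j\<bar> else 0)) (at 0)"
  proof (cases "i = j")
    case True
    have "(deriv r has_real_derivative deriv (deriv r) \<bar>x $ j\<bar>) (at \<bar>x $ j\<bar>)"
      using r(2)[of "\<bar>x $ j\<bar>"] xj by (simp add: DERIV_deriv_iff_real_differentiable)
    from has_real_derivative_compose_abs[OF this xj]
    have "((\<lambda>t. deriv r \<bar>x $ j + t\<bar>) has_real_derivative sgn (x $ j) * deriv (deriv r) \<bar>x $ j\<bar>) (at 0)"
      using DERIV_shift[of "\<lambda>t. deriv r \<bar>t\<bar>" _ 0 "x $ j"] by (simp add: add.commute)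
    from DERIV_cmult[OF this, of "sgn (x $ j)"] show ?thesis
      using True xj by (simp add: sgn_mult_self_eq flip: mult.assoc)
  qed (simp add: axis_def)
  have "deriv (\<lambda>t. partial j (obj f lam r) (?y t)) 0 =
      deriv (\<lambda>t. g (?y t) $ j + lam * (sgn (x $ j) * deriv r \<bar>?y t $ j\<bar>)) 0"
    by (rule deriv_cong_ev[OF ev refl])
  also have "\<dots> = L (axis i 1) $ j + lam * (if i = j then deriv (deriv r) \<bar>x $ j\<bar> else 0)"
    by (rule DERIV_imp_deriv[OF DERIV_add[OF d1 DERIV_cmult[OF d2]]])
  finally show ?thesis
    unfolding partial_def[of i] by simp
qed

section \<open>The map \<open>Sx\<close> and its derivative at a stationary point\<close>

lemma Sx_nth_finite:
  assumes "(x $ i, e $ i) \<noteq> (0, 0)"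
  shows "Sx f lam r bet x e $ i = (x $ i - 1 / bet * partial i f x) /
    (1 + lam / bet * (deriv r (sqrt ((x $ i)\<^sup>2 + (e $ i)\<^sup>2)) / sqrt ((x $ i)\<^sup>2 + (e $ i)\<^sup>2)))"
proof -
  define s where "s = sqrt ((x $ i)\<^sup>2 + (e $ i)\<^sup>2)"
  have "weight r (x $ i) (e $ i) = ereal (deriv r s / (2 * s))"
    using assms by (simp add: weight_def s_def)
  then have "Sx f lam r bet x e $ i =
      inverse (1 + 2 * lam / bet * (deriv r s / (2 * s))) * (x $ i - 1 / bet * partial i f x)"
    by (simp add: Sx_def)
  also have "2 * lam / bet * (deriv r s / (2 * s)) = lam / bet * (deriv r s / s)"
    by simp
  finally show ?thesis
    unfolding s_def by (simp only: divide_inverse mult.commute)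
qed

lemma Sx_nth_infinite:
  "x $ i = 0 \<Longrightarrow> e $ i = 0 \<Longrightarrow> Sx f lam r bet x e $ i = 0"
  by (simp add: Sx_def weight_def)

text \<open>At a nonzero coordinate stationarity turns the gradient step into
  \<open>x $ i * c\<close>, and \<open>c\<close> is exactly the denominator. At a zero coordinate
  the infinite weight gives 0.\<close>

lemma Sx_stationary:
  assumes st: "x $ i \<noteq> 0 \<Longrightarrow> partial i f x = - lam * sgn (x $ i) * deriv r \<bar>x $ i\<bar>"
    and "bet > 0" "lam \<ge> 0" "deriv r \<bar>x $ i\<bar> \<ge> 0"
  shows "Sx f lam r bet x 0 $ i = x $ i"
proof (cases "x $ i = 0")
  case False
  define c where "c = 1 + lam / bet * (deriv r \<bar>x $ i\<bar> / \<bar>x $ i\<bar>)"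
  have "c > 0" unfolding c_def using assms by (intro add_pos_nonneg) auto
  have "x $ i * c = x $ i + lam / bet * (sgn (x $ i) * deriv r \<bar>x $ i\<bar>)"
    using False by (simp add: c_def distrib_left sgn_if)
  also have "\<dots> = x $ i - 1 / bet * partial i f x"
    using st[OF False] by simp
  finally have "x $ i - 1 / bet * partial i f x = x $ i * c" ..
  moreover have "Sx f lam r bet x 0 $ i = (x $ i - 1 / bet * partial i f x) / c"
    using False by (simp add: Sx_nth_finite c_def)
  ultimately show ?thesis using \<open>c > 0\<close> by simp
qed (simp add: Sx_nth_infinite)

text \<open>Near the point the component is a quotient \<open>N / Q\<close> with
  \<open>Q = c\<close> and, by stationarity, \<open>N = x $ i * c\<close> there. The quotient rule
  thus reduces to (N' - x_i Q') / c, in which the first derivative of \<open>r\<close> cancels up to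
  the factor \<open>c\<close>.\<close>

lemma Sx_has_derivative_nz:
  fixes x :: "real^'n"
  assumes f: "\<And>y. (f has_derivative (\<lambda>h. g y \<bullet> h)) (at y)"
    and g: "(g has_derivative L) (at x)"
    and r: "deriv r differentiable (at \<bar>x $ i\<bar>)" and pos: "deriv r \<bar>x $ i\<bar> \<ge> 0"
    and xi: "x $ i \<noteq> 0"
    and st: "g x $ i = - lam * sgn (x $ i) * deriv r \<bar>x $ i\<bar>"
    and lam: "lam \<ge> 0" and bet: "bet > 0"
    and c_def: "c = 1 + lam / bet * (deriv r \<bar>x $ i\<bar> / \<bar>x $ i\<bar>)"
  shows "((\<lambda>p. Sx f lam r bet (fst p) (snd p) $ i) has_derivative
     (\<lambda>h. fst h $ i - (L (fst h) $ i + lam * deriv (deriv r) \<bar>x $ i\<bar> * fst h $ i) / (bet * c)))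
     (at (x, 0))"
proof -
  have part: "partial i f y = g y $ i" for y
    using partial_eq[OF f, of i y] by (simp add: inner_axis)
  define s where "s p = sqrt ((fst p $ i)\<^sup>2 + (snd p $ i)\<^sup>2)" for p :: "(real^'n) \<times> (real^'n)"
  have "c > 0" unfolding c_def using pos lam bet by (intro add_pos_nonneg) auto
  have s0: "s (x, 0) = \<bar>x $ i\<bar>" by (simp add: s_def)
  have nth: "(F has_derivative F') A \<Longrightarrow> ((\<lambda>p. F p $ i) has_derivative (\<lambda>h. F' h $ i)) A"
    for F F' and A :: "((real^'n) \<times> (real^'n)) filter"
    by (rule bounded_linear.has_derivative[OF bounded_linear_vec_nth])
  \<comment> \<open>The square of the smoothing coordinate has derivative 0 at 0, so only the
    \<open>x\<close> part contributes.\<close>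
  have ds: "(s has_derivative (\<lambda>h. sgn (x $ i) * fst h $ i)) (at (x, 0))"
  proof -
    have dsq: "((\<lambda>p::(real^'n) \<times> (real^'n). (fst p $ i)\<^sup>2 + (snd p $ i)\<^sup>2) has_derivative
        (\<lambda>h. 2 * x $ i * fst h $ i)) (at (x, 0))"
      by (rule has_derivative_eq_rhs, (rule derivative_intros nth)+) (simp add: mult_ac)
    have "(sqrt has_real_derivative inverse (sqrt ((x $ i)\<^sup>2)) / 2)
        (at ((fst (x, 0::real^'n) $ i)\<^sup>2 + (snd (x, 0::real^'n) $ i)\<^sup>2))"
      using xi DERIV_real_sqrt[of "(x $ i)\<^sup>2"] by simp
    from DERIV_compose_FDERIV[OF this dsq]
    have "(s has_derivative (\<lambda>h. 2 * x $ i * fst h $ i * (inverse (sqrt ((x $ i)\<^sup>2)) / 2))) (at (x, 0))"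
      by (simp add: s_def[abs_def])
    moreover have "2 * x $ i * t * (inverse (sqrt ((x $ i)\<^sup>2)) / 2) = sgn (x $ i) * t" for t
      using xi by (simp add: sgn_if)
    ultimately show ?thesis by (simp only:)
  qed
  have "((\<lambda>p::(real^'n) \<times> (real^'n). g (fst p)) has_derivative (\<lambda>h. L (fst h))) (at (x, 0))"
    by (rule has_derivative_compose[of fst]) (auto intro!: derivative_eq_intros simp: g)
  then have dg: "((\<lambda>p::(real^'n) \<times> (real^'n). g (fst p) $ i) has_derivative (\<lambda>h. L (fst h) $ i)) (at (x, 0))"
    by (rule nth)
  define N where "N p = fst p $ i - 1 / bet * g (fst p) $ i" for p :: "(real^'n) \<times> (real^'n)"
  define Q where "Q p = 1 + lam / bet * (deriv r (s p) / s p)" for p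
  have dN: "(N has_derivative (\<lambda>h. fst h $ i - 1 / bet * L (fst h) $ i)) (at (x, 0))"
    unfolding N_def
    by (rule has_derivative_eq_rhs, (rule derivative_intros nth dg)+) simp
  define q where "q = sgn (x $ i) * (lam / bet *
    ((deriv (deriv r) \<bar>x $ i\<bar> * \<bar>x $ i\<bar> - deriv r \<bar>x $ i\<bar>) / (\<bar>x $ i\<bar> * \<bar>x $ i\<bar>)))"
  have "(deriv r has_real_derivative deriv (deriv r) \<bar>x $ i\<bar>) (at \<bar>x $ i\<bar>)"
    using r by (simp add: DERIV_deriv_iff_real_differentiable)
  from DERIV_divide[OF this DERIV_ident]
  have "((\<lambda>t. deriv r t / t) has_real_derivative
      (deriv (deriv r) \<bar>x $ i\<bar> * \<bar>x $ i\<bar> - deriv r \<bar>x $ i\<bar>) / (\<bar>x $ i\<bar> * \<bar>x $ i\<bar>)) (at (s (x, 0)))"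
    using xi by (simp add: s0)
  from DERIV_compose_FDERIV[OF DERIV_add[OF DERIV_const[of 1] DERIV_cmult[OF this, of "lam / bet"]] ds]
  have dQ: "(Q has_derivative (\<lambda>h. q * fst h $ i)) (at (x, 0))"
    by (simp add: Q_def[abs_def] q_def mult_ac)
  have Q0: "Q (x, 0) = c" by (simp add: Q_def s0 c_def)
  have N0: "N (x, 0) = x $ i * c"
    using xi by (simp add: N_def st c_def sgn_if field_simps)
  have "((\<lambda>p. N p / Q p) has_derivative
     (\<lambda>h. (fst h $ i - 1 / bet * L (fst h) $ i - x $ i * q * fst h $ i) / c)) (at (x, 0))"
    by (rule has_derivative_eq_rhs[OF has_derivative_divide'[OF dN dQ]])
      (use \<open>c > 0\<close> in \<open>simp_all add: Q0 N0 fun_eq_iff diff_divide_distrib\<close>)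
  moreover have "(fst h $ i - 1 / bet * L (fst h) $ i - x $ i * q * fst h $ i) / c =
      fst h $ i - (L (fst h) $ i + lam * deriv (deriv r) \<bar>x $ i\<bar> * fst h $ i) / (bet * c)"
    for h :: "(real^'n) \<times> (real^'n)"
  proof -
    define a A B where "a = \<bar>x $ i\<bar>" and "A = deriv (deriv r) \<bar>x $ i\<bar>" and "B = deriv r \<bar>x $ i\<bar>"
    have "a > 0" using xi by (simp add: a_def)
    have c: "c = 1 + lam / bet * (B / a)" by (simp only: c_def a_def B_def)
    have "x $ i * sgn (x $ i) = a" by (simp add: abs_sgn a_def)
    moreover have "x $ i * q = x $ i * sgn (x $ i) * (lam / bet * ((A * a - B) / (a * a)))"
      by (simp only: q_def a_def A_def B_def mult.assoc)
    ultimately have "x $ i * q = a * (lam / bet * ((A * a - B) / (a * a)))"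
      by (simp only:)
    also have "\<dots> = lam / bet * A - (c - 1)"
      using \<open>a > 0\<close> bet by (simp add: c diff_divide_distrib right_diff_distrib)
    \<comment> \<open>The summand \<open>c - 1\<close> joins the coefficient 1 of
      \<open>fst h $ i\<close>; division by \<open>c\<close> then leaves the identity term.\<close>
    finally have xq: "x $ i * q = lam / bet * A - (c - 1)" .
    have "fst h $ i - 1 / bet * L (fst h) $ i - x $ i * q * fst h $ i =
      c * fst h $ i - (L (fst h) $ i + lam * deriv (deriv r) \<bar>x $ i\<bar> * fst h $ i) / bet"
      unfolding xq A_def[symmetric] using bet by (simp add: add_divide_distrib left_diff_distrib)
    then show ?thesis using \<open>c > 0\<close> by (simp add: diff_divide_distrib)
  qed
  ultimately have *: "((\<lambda>p. N p / Q p) has_derivative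
     (\<lambda>h. fst h $ i - (L (fst h) $ i + lam * deriv (deriv r) \<bar>x $ i\<bar> * fst h $ i) / (bet * c))) (at (x, 0))"
    by simp
  have "open {p :: (real^'n) \<times> (real^'n). fst p $ i \<noteq> 0}"
    by (intro open_Collect_neq continuous_intros)
  then show ?thesis
    by (rule has_derivative_transform_within_open[OF *])
      (use xi in \<open>auto simp: Sx_nth_finite part N_def Q_def s_def\<close>)
qed

text \<open>The numerator stays below some \<open>K\<close> near \<open>x\<close>, while the
  denominator exceeds \<open>K / (e * s)\<close> once \<open>deriv r\<close> is large enough. The
  component is then at most \<open>e * s\<close>, and \<open>s\<close> is at most the distance to
  \<open>(x, 0)\<close> because \<open>x $ i = 0\<close>.\<close>

lemma Sx_has_derivative_zr:
  fixes x :: "real^'n"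
  assumes f: "\<And>y. (f has_derivative (\<lambda>h. g y \<bullet> h)) (at y)"
    and g: "continuous (at x) g"
    and r: "filterlim (deriv r) at_top (at_right 0)"
    and xi: "x $ i = 0" and lam: "lam > 0" and bet: "bet > 0"
  shows "((\<lambda>p. Sx f lam r bet (fst p) (snd p) $ i) has_derivative (\<lambda>h. 0)) (at (x, 0))"
  unfolding has_derivative_at_alt
proof (intro conjI allI impI)
  fix e :: real assume "e > 0"
  have part: "partial i f y = g y $ i" for y
    using partial_eq[OF f, of i y] by (simp add: inner_axis)
  define N where "N y = y $ i - 1 / bet * g y $ i" for y
  define K where "K = \<bar>N x\<bar> + 1"
  have "isCont N x" unfolding N_def by (intro continuous_intros g)
  then obtain d1 where "d1 > 0" and d1: "\<And>y. dist y x < d1 \<Longrightarrow> \<bar>N y - N x\<bar> < 1"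
    unfolding continuous_at_eps_delta dist_real_def by (meson zero_less_one)
  \<comment> \<open>The threshold is the value of \<open>deriv r\<close> at which
    \<open>lam / bet * deriv r t\<close> reaches \<open>K / e\<close>.\<close>
  obtain d2 where "d2 > 0" and d2: "\<And>t. 0 < t \<Longrightarrow> t < d2 \<Longrightarrow> deriv r t \<ge> bet * K / (lam * e)"
    using r unfolding filterlim_at_top eventually_at_right_field by meson
  have "norm (Sx f lam r bet (fst p) (snd p) $ i - Sx f lam r bet (fst (x, 0)) (snd (x, 0)) $ i - 0)
      \<le> e * norm (p - (x, 0))" if p: "norm (p - (x, 0)) < min d1 d2" for p
  proof (cases "(fst p $ i, snd p $ i) = (0, 0)")
    case True
    then show ?thesis using \<open>e > 0\<close> xi by (simp add: Sx_nth_infinite)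
  next
    case False
    define s where "s = sqrt ((fst p $ i)\<^sup>2 + (snd p $ i)\<^sup>2)"
    have "s > 0" using False by (auto simp: s_def sum_power2_gt_zero_iff)
    have "\<bar>fst p $ i\<bar> \<le> norm (fst p - x)" "\<bar>snd p $ i\<bar> \<le> norm (snd p)"
      using component_le_norm_cart[of "fst p - x" i] component_le_norm_cart[of "snd p" i] xi by auto
    then have "(fst p $ i)\<^sup>2 \<le> (norm (fst p - x))\<^sup>2" "(snd p $ i)\<^sup>2 \<le> (norm (snd p))\<^sup>2"
      by (metis power2_abs power_mono abs_ge_zero)+
    then have "s \<le> norm (p - (x, 0))"
      unfolding s_def norm_prod_def
      by (intro real_sqrt_le_mono add_mono) simp_all
    have "norm (fst p - x) < d1"
      using p norm_fst_le[of "fst p - x" "snd p"] by (cases p) auto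
    then have "\<bar>N (fst p)\<bar> \<le> K" using d1[of "fst p"] by (simp add: K_def dist_norm)
    have "K > 0" by (simp add: K_def)
    have big: "lam / bet * deriv r s \<ge> K / e"
      using d2[of s] \<open>s > 0\<close> \<open>s \<le> norm (p - (x, 0))\<close> p lam bet \<open>e > 0\<close> by (simp add: field_simps)
    have "K / e > 0" using \<open>K > 0\<close> \<open>e > 0\<close> by simp
    have "K / (e * s) \<le> 1 + lam / bet * (deriv r s / s)"
      using divide_right_mono[OF big, of s] \<open>s > 0\<close> by simp
    then have "\<bar>N (fst p) / (1 + lam / bet * (deriv r s / s))\<bar> \<le> K / (K / (e * s))"
      using \<open>\<bar>N (fst p)\<bar> \<le> K\<close> \<open>K > 0\<close> \<open>e > 0\<close> \<open>s > 0\<close> unfolding abs_divide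
      by (intro frac_le) simp_all
    also have "\<dots> = e * s" using \<open>K > 0\<close> by simp
    also have "\<dots> \<le> e * norm (p - (x, 0))"
      using \<open>s \<le> norm (p - (x, 0))\<close> \<open>e > 0\<close> by simp
    finally show ?thesis
      using False xi by (simp add: Sx_nth_finite Sx_nth_infinite part N_def s_def)
  qed
  then show "\<exists>d>0. \<forall>p. norm (p - (x, 0)) < d \<longrightarrow>
      norm (Sx f lam r bet (fst p) (snd p) $ i - Sx f lam r bet (fst (x, 0)) (snd (x, 0)) $ i - 0)
      \<le> e * norm (p - (x, 0))"
    using \<open>d1 > 0\<close> \<open>d2 > 0\<close> by (intro exI[of _ "min d1 d2"]) auto
qed simp

section \<open>The Jacobian of \<open>Tmap\<close>\<close>

lemma has_derivative_vec_nthI: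
  fixes F :: "'a::real_normed_vector \<Rightarrow> real^'n"
  assumes "\<And>i. ((\<lambda>p. F p $ i) has_derivative (\<lambda>h. F' h $ i)) (at x)"
  shows "(F has_derivative F') (at x)"
  using assms by (subst has_derivative_componentwise_within) (auto simp: Basis_vec_def inner_axis)

text \<open>At a zero coordinate only the damping \<open>1 - alp\<close> survives; at a nonzero one
  the identity terms with weights \<open>1 - alp\<close> and \<open>alp\<close> recombine to 1. The
  full \<open>L (fst h)\<close> appears since nonzero rows may also see zero coordinates.\<close>

lemma Tmap_has_derivative:
  fixes x :: "real^'n"
  assumes f: "\<And>y. (f has_derivative (\<lambda>h. g y \<bullet> h)) (at y)"
    and g: "(g has_derivative L) (at x)"
    and r: "A1 r" "filterlim (deriv r) at_top (at_right 0)"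
    and st: "\<And>i. x $ i \<noteq> 0 \<Longrightarrow> partial i f x = - lam * sgn (x $ i) * deriv r \<bar>x $ i\<bar>"
    and lam: "lam > 0" and bet: "bet > 0"
  shows "(Tmap f lam r bet alp mu has_derivative
    (\<lambda>h. ((\<chi> i. if x $ i = 0 then (1 - alp) * fst h $ i
      else fst h $ i - alp * (L (fst h) $ i + lam * deriv (deriv r) \<bar>x $ i\<bar> * fst h $ i) /
        (bet * (1 + lam / bet * (deriv r \<bar>x $ i\<bar> / \<bar>x $ i\<bar>)))),
      (1 - alp * (1 - mu)) *\<^sub>R snd h))) (at (x, 0))"
    (is "(_ has_derivative (\<lambda>h. (?X h, _))) _")
proof -
  have "((\<lambda>p. (1 - alp) *\<^sub>R fst p + alp *\<^sub>R Sx f lam r bet (fst p) (snd p)) has_derivative ?X) (at (x, 0))"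
  proof (rule has_derivative_vec_nthI)
    fix i
    have dfst: "((\<lambda>p::(real^'n) \<times> (real^'n). fst p $ i) has_derivative (\<lambda>h. fst h $ i)) (at (x, 0))"
      by (intro bounded_linear_imp_has_derivative bounded_linear_compose[OF bounded_linear_vec_nth bounded_linear_fst])
    show "((\<lambda>p. ((1 - alp) *\<^sub>R fst p + alp *\<^sub>R Sx f lam r bet (fst p) (snd p)) $ i) has_derivative
        (\<lambda>h. ?X h $ i)) (at (x, 0))"
    proof (cases "x $ i = 0")
      case True
      have "((\<lambda>p. Sx f lam r bet (fst p) (snd p) $ i) has_derivative (\<lambda>h. 0)) (at (x, 0))"
        by (rule Sx_has_derivative_zr[OF f has_derivative_continuous[OF g] r(2) True lam bet])
      from has_derivative_add[OF has_derivative_mult_right[OF dfst, of "1 - alp"]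
          has_derivative_mult_right[OF this, of alp]]
      show ?thesis using True by simp
    next
      case False
      have "deriv r differentiable (at \<bar>x $ i\<bar>)" "deriv r \<bar>x $ i\<bar> \<ge> 0"
        using r(1) False by (auto simp: A1_def)
      moreover have "g x $ i = - lam * sgn (x $ i) * deriv r \<bar>x $ i\<bar>"
        using st[OF False] partial_eq[OF f, of i x] by (simp add: inner_axis)
      ultimately have "((\<lambda>p. Sx f lam r bet (fst p) (snd p) $ i) has_derivative
         (\<lambda>h. fst h $ i - (L (fst h) $ i + lam * deriv (deriv r) \<bar>x $ i\<bar> * fst h $ i) /
          (bet * (1 + lam / bet * (deriv r \<bar>x $ i\<bar> / \<bar>x $ i\<bar>))))) (at (x, 0))"
        using False lam bet by (intro Sx_has_derivative_nz[OF f g]) auto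
      from has_derivative_add[OF has_derivative_mult_right[OF dfst, of "1 - alp"]
          has_derivative_mult_right[OF this, of alp]]
      show ?thesis using False
        by (simp add: left_diff_distrib right_diff_distrib)
    qed
  qed
  from has_derivative_Pair[OF this has_derivative_scaleR_right[OF bounded_linear_imp_has_derivative[OF bounded_linear_snd]]]
  show ?thesis
    by (simp add: Tmap_def case_prod_beta')
qed

section \<open>The Hessian block and its weighted eigenvalue problem\<close>

text \<open>Iterated partials give \<open>L (axis i 1) $ j\<close>; symmetry swaps the indices so
  that the entries become those of \<open>matrix L\<close>.\<close>

lemma nz_hessian_obj:
  fixes x :: "real^'n"
  assumes f: "\<And>y. (f has_derivative (\<lambda>h. g y \<bullet> h)) (at y)"
    and g: "(g has_derivative L) (at x)"
    and r: "A1 r"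
  shows "nz_hessian (obj f lam r) x = (\<chi> i j. if i \<in> nz x \<and> j \<in> nz x
    then L (axis j 1) $ i + (if i = j then lam * deriv (deriv r) \<bar>x $ i\<bar> else 0) else 0)"
proof -
  have "L (axis i 1) $ j = L (axis j 1) $ i" for i j
    using second_derivative_symmetric[OF f g, of "axis i 1" "axis j 1"] by (simp add: inner_axis)
  then have "partial i (partial j (obj f lam r)) x =
      L (axis j 1) $ i + (if i = j then lam * deriv (deriv r) \<bar>x $ i\<bar> else 0)" if "j \<in> nz x" for i j
    using partial_partial_obj[OF f g, of r j i lam] r that by (auto simp: A1_def nz_def)
  then show ?thesis
    unfolding nz_hessian_def by (auto simp: vec_eq_iff)
qed

text \<open>The columns zeroed by the padding only meet zero entries of \<open>h\<close>.\<close>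

lemma nz_hessian_mult:
  fixes x :: "real^'n"
  assumes f: "\<And>y. (f has_derivative (\<lambda>h. g y \<bullet> h)) (at y)"
    and g: "(g has_derivative L) (at x)"
    and r: "A1 r" and h: "h \<in> nz_space x" and i: "i \<in> nz x"
  shows "(nz_hessian (obj f lam r) x *v h) $ i = L h $ i + lam * deriv (deriv r) \<bar>x $ i\<bar> * h $ i"
proof -
  have "(nz_hessian (obj f lam r) x *v h) $ i =
      (\<Sum>j\<in>UNIV. matrix L $ i $ j * h $ j + (if i = j then lam * deriv (deriv r) \<bar>x $ i\<bar> * h $ i else 0))"
    unfolding matrix_vector_mult_def nz_hessian_obj[OF f g r]
    using i h by (auto simp: matrix_def nz_space_def distrib_right intro!: sum.cong)
  also have "\<dots> = (matrix L *v h) $ i + lam * deriv (deriv r) \<bar>x $ i\<bar> * h $ i"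
    by (simp add: sum.distrib matrix_vector_mult_def)
  finally show ?thesis
    using has_derivative_linear[OF g] by (simp add: matrix_works)
qed

lemma nz_hessian_mult_zr:
  "i \<notin> nz x \<Longrightarrow> (nz_hessian F x *v h) $ i = 0"
  by (simp add: nz_hessian_def matrix_vector_mult_def)

lemma transpose_nz_hessian_obj:
  fixes x :: "real^'n"
  assumes f: "\<And>y. (f has_derivative (\<lambda>h. g y \<bullet> h)) (at y)"
    and g: "(g has_derivative L) (at x)"
    and r: "A1 r"
  shows "transpose (nz_hessian (obj f lam r) x) = nz_hessian (obj f lam r) x"
proof -
  have "L (axis i 1) $ j = L (axis j 1) $ i" for i j
    using second_derivative_symmetric[OF f g, of "axis i 1" "axis j 1"] by (simp add: inner_axis)
  then show ?thesis
    unfolding nz_hessian_obj[OF f g r] by (auto simp: transpose_def vec_eq_iff)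
qed

text \<open>This is the generalized eigenproblem A v = k C v with C = diag(c). With \<open>R\<close>
  as C^(-1/2), the map \<open>R (A *v R w)\<close> is self-adjoint, and \<open>R\<close> carries its
  eigenvectors to solutions.\<close>

lemma symmetric_matrix_weighted_negative_eigenvalue:
  fixes A :: "real^'n^'n"
  assumes A: "transpose A = A" and c: "\<And>i. c i > 0" and d: "d \<bullet> (A *v d) < 0"
  obtains k v where "k < 0" "v \<noteq> 0" "\<And>i. (A *v v) $ i = k * c i * v $ i"
proof -
  define R where "R w = (\<chi> i. w $ i / sqrt (c i))" for w :: "real^'n"
  have R: "linear R"
    by (rule linearI) (auto simp: R_def vec_eq_iff add_divide_distrib)
  have R_adj: "R u \<bullet> w = u \<bullet> R w" for u w
    by (simp add: R_def inner_vec_def)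
  have A_adj: "(A *v u) \<bullet> w = u \<bullet> (A *v w)" for u w
    by (metis A dot_lmul_matrix transpose_matrix_vector)
  \<comment> \<open>The preimage of \<open>d\<close> under \<open>R\<close>, on which the
    transformed form takes the same negative value.\<close>
  define e where "e = (\<chi> i. d $ i * sqrt (c i))"
  have "sqrt (c i) \<noteq> 0" for i using c[of i] by simp
  then have "R e = d" by (simp add: R_def e_def vec_eq_iff)
  let ?B = "\<lambda>w. R (A *v R w)"
  have "linear ?B"
    using linear_compose[OF linear_compose[OF R matrix_vector_mul_linear] R] by (simp add: o_def)
  moreover have "?B u \<bullet> w = u \<bullet> ?B w" for u w
    by (metis R_adj A_adj)
  moreover have "e \<bullet> ?B e < 0"
    using d by (simp add: \<open>R e = d\<close> flip: R_adj)
  ultimately obtain k w where k: "k < 0" and w: "w \<noteq> 0" "?B w = k *\<^sub>R w"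
    using selfadjoint_negative_eigenvalue by blast
  have eig: "(A *v R w) $ i = k * c i * R w $ i" for i
  proof -
    have "(A *v R w) $ i / sqrt (c i) = k * w $ i"
      using arg_cong[OF w(2), of "\<lambda>v. v $ i"] by (simp add: R_def)
    then have "(A *v R w) $ i = k * w $ i * sqrt (c i)"
      using c[of i] by (simp add: field_simps)
    moreover have "w $ i = sqrt (c i) * R w $ i" "c i = sqrt (c i) * sqrt (c i)"
      using c[of i] by (simp_all add: R_def)
    ultimately show ?thesis by (metis mult.assoc mult.commute)
  qed
  have "R w \<noteq> 0"
  proof
    assume "R w = 0"
    then have "w $ i / sqrt (c i) = 0" for i by (simp add: R_def vec_eq_iff)
    then have "w = 0" using \<open>\<And>i. sqrt (c i) \<noteq> 0\<close> by (simp add: vec_eq_iff)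
    with w show False by simp
  qed
  then show ?thesis using that[OF k _ eig] by blast
qed

section \<open>Eigenvalue and kernel of the Jacobian at a strict saddle\<close>

theorem theorem4p6:
  fixes f :: "real^'n \<Rightarrow> real" and r :: "real \<Rightarrow> real"
    and lam bet alp mu rho F0 :: real
    and x0 e0 xs :: "real^'n"
  assumes "C2_fun f" and "lam > 0"
    and "A1 r"
    and "A2 (obj f lam r)"
    and "F0 = obj_smooth f lam r x0 e0"
    and "A3 (obj f lam r) F0"
    and "A4 r"
    and "rho > 0"
    and "\<And>x. x \<in> level_set (obj f lam r) F0 \<Longrightarrow> stationary f lam r x \<Longrightarrow>
           spectral_norm (nz_hessian (obj f lam r) x) \<le> rho"
    and "bet > 0" and "0 < alp" and "alp < 1" and "0 < mu" and "mu < 1"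
    and "xs \<in> level_set (obj f lam r) F0"
    and "strict_saddle f lam r xs"
  shows "unstable_fixed_point (Tmap f lam r bet alp mu) (xs, 0)
    \<and> (alp < bet / rho \<longrightarrow> bij (frechet_derivative (Tmap f lam r bet alp mu) (at (xs, 0))))"
proof -
  obtain g H where f: "\<And>y. (f has_derivative (\<lambda>h. g y \<bullet> h)) (at y)"
    and g: "\<And>y. (g has_derivative (\<lambda>h. H y *v h)) (at y)"
    using \<open>C2_fun f\<close> unfolding C2_fun_def by blast
  let ?T = "Tmap f lam r bet alp mu"
  let ?A = "nz_hessian (obj f lam r) xs"
  have saddle: "stationary f lam r xs" "\<exists>d\<in>nz_space xs. d \<bullet> (?A *v d) < 0"
    using \<open>strict_saddle f lam r xs\<close> by (auto simp: strict_saddle_def)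
  have st: "partial i f xs = - lam * sgn (xs $ i) * deriv r \<bar>xs $ i\<bar>" if "xs $ i \<noteq> 0" for i
    using saddle(1) that by (auto simp: stationary_def nz_def)
  have r': "deriv r t \<ge> 0" if "t > 0" for t
    using \<open>A1 r\<close> that by (simp add: A1_def)
  define c where "c i = 1 + lam / bet * (deriv r \<bar>xs $ i\<bar> / \<bar>xs $ i\<bar>)" for i
  \<comment> \<open>At zero coordinates division by \<open>0\<close> makes \<open>c i = 1\<close>.\<close>
  have c1: "c i \<ge> 1" for i
    using r'[of "\<bar>xs $ i\<bar>"] \<open>lam > 0\<close> \<open>bet > 0\<close> by (cases "xs $ i = 0") (simp_all add: c_def)
  then have c0: "c i > 0" for i using less_le_trans zero_less_one by blast
  define D where "D h = ((\<chi> i. if xs $ i = 0 then (1 - alp) * fst h $ i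
      else fst h $ i - alp * ((H xs *v fst h) $ i + lam * deriv (deriv r) \<bar>xs $ i\<bar> * fst h $ i) /
        (bet * c i)), (1 - alp * (1 - mu)) *\<^sub>R snd h)" for h :: "(real^'n) \<times> (real^'n)"
  have D: "(?T has_derivative D) (at (xs, 0))"
    unfolding D_def[abs_def] c_def
    using \<open>A4 r\<close> by (intro Tmap_has_derivative[OF f g \<open>A1 r\<close> _ st \<open>lam > 0\<close> \<open>bet > 0\<close>]) (auto simp: A4_def)
  then have fD: "frechet_derivative ?T (at (xs, 0)) = D"
    by (rule frechet_derivative_at[symmetric])
  have "linear D" using D by (rule has_derivative_linear)
  \<comment> \<open>One formula covers all coordinates: at a zero coordinate both
    \<open>h $ i\<close> and the padded row of \<open>?A\<close> vanish.\<close>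
  have D_nz: "D (h, 0) = ((\<chi> i. h $ i - alp * (?A *v h) $ i / (bet * c i)), 0)" if h: "h \<in> nz_space xs" for h
    using h nz_hessian_mult[OF f g \<open>A1 r\<close> h, of _ lam] nz_hessian_mult_zr[of _ xs "obj f lam r" h]
    by (auto simp: D_def vec_eq_iff nz_space_def nz_def)
  have "Sx f lam r bet xs 0 $ i = xs $ i" for i
    using Sx_stationary[OF st] Sx_nth_infinite[of xs i 0] r'[of "\<bar>xs $ i\<bar>"] \<open>lam > 0\<close> \<open>bet > 0\<close>
    by (cases "xs $ i = 0") auto
  then have "Sx f lam r bet xs 0 = xs" by (simp add: vec_eq_iff)
  then have "?T (xs, 0) = (xs, 0)"
    by (simp add: Tmap_def flip: scaleR_add_left)
  moreover have "?T differentiable (at (xs, 0))"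
    using D by (auto simp: differentiable_def)
  moreover have "\<exists>z. eigval D z \<and> cmod z > 1"
  proof -
    obtain d where "d \<bullet> (?A *v d) < 0" using saddle(2) by blast
    then obtain k v where k: "k < 0" and "v \<noteq> 0" and v: "\<And>i. (?A *v v) $ i = k * c i * v $ i"
      by (rule symmetric_matrix_weighted_negative_eigenvalue
          [where c = c, OF transpose_nz_hessian_obj[OF f g \<open>A1 r\<close>] c0]) (rule that)
    \<comment> \<open>Rows of \<open>?A\<close> at zero coordinates are 0, while
      \<open>k * c i\<close> is not, so the eigenvector is supported on the nonzero
      coordinates.\<close>
    have "v \<in> nz_space xs"
      unfolding nz_space_def
    proof (intro CollectI allI impI)
      fix i assume "i \<notin> nz xs"
      then have "k * c i * v $ i = 0" using nz_hessian_mult_zr v by metis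
      then show "v $ i = 0" using k c0[of i] by simp
    qed
    define m where "m = 1 - alp * k / bet"
    have "D (v, 0) = m *\<^sub>R (v, 0)"
      unfolding D_nz[OF \<open>v \<in> nz_space xs\<close>]
      using c0 by (simp add: v m_def vec_eq_iff c0[THEN less_imp_neq, symmetric] left_diff_distrib)
    \<comment> \<open>A real eigenvector enters the complexification with imaginary part 0.\<close>
    then have "eigval D (complex_of_real m)"
      unfolding eigval_def complex_scale_def
      using \<open>v \<noteq> 0\<close> linear_0[OF \<open>linear D\<close>] by (intro exI[of _ "((v, 0), 0)"]) (simp add: zero_prod_def)
    moreover have "m > 1"
      using k \<open>0 < alp\<close> \<open>bet > 0\<close> by (simp add: m_def divide_less_0_iff mult_less_0_iff)
    ultimately show ?thesis by (intro exI[of _ "complex_of_real m"]) simp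
  qed
  moreover have "bij D" if alp: "alp < bet / rho"
  proof -
    have "h = 0" if "D h = 0" for h
    proof -
      have "1 - alp * (1 - mu) > 0"
        using \<open>0 < alp\<close> \<open>alp < 1\<close> \<open>0 < mu\<close> \<open>mu < 1\<close> mult_strict_mono[of alp 1 "1 - mu" 1] by simp
      then have "snd h = 0" using that by (simp add: D_def zero_prod_def)
      \<comment> \<open>At zero coordinates \<open>D\<close> multiplies by \<open>1 - alp\<close>,
        which is nonzero.\<close>
      have "fst h \<in> nz_space xs"
        using that \<open>alp < 1\<close> by (auto simp: D_def zero_prod_def vec_eq_iff nz_space_def nz_def split: if_splits)
      obtain u where u: "h = (u, 0)" using \<open>snd h = 0\<close> by (cases h) auto
      have "u \<in> nz_space xs" using \<open>fst h \<in> nz_space xs\<close> u by simp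
      \<comment> \<open>The kernel equation with denominators cleared; pairing it with
        \<open>u\<close> yields the energy estimate that follows.\<close>
      have *: "alp * (?A *v u) $ i = bet * (c i * u $ i)" for i
        using that c0[of i] \<open>bet > 0\<close> unfolding u D_nz[OF \<open>u \<in> nz_space xs\<close>]
        by (simp add: zero_prod_def vec_eq_iff field_simps)
      have "bet * (norm u)\<^sup>2 = bet * (\<Sum>i\<in>UNIV. (u $ i)\<^sup>2)"
        unfolding power2_norm_eq_inner inner_vec_def by (simp add: power2_eq_square)
      also have "\<dots> \<le> bet * (\<Sum>i\<in>UNIV. c i * (u $ i)\<^sup>2)"
        using \<open>bet > 0\<close> mult_right_mono[OF c1 zero_le_power2]
        by (intro mult_left_mono sum_mono) simp_all
      also have "\<dots> = (\<Sum>i\<in>UNIV. u $ i * (bet * (c i * u $ i)))"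
        by (simp add: sum_distrib_left power2_eq_square mult_ac)
      also have "\<dots> = alp * (u \<bullet> (?A *v u))"
        unfolding *[symmetric] inner_vec_def by (simp add: sum_distrib_left mult_ac)
      also have "u \<bullet> (?A *v u) \<le> rho * (norm u)\<^sup>2"
      proof -
        have "norm (?A *v u) \<le> onorm ((*v) ?A) * norm u"
          by (rule onorm) (rule matrix_vector_mul_bounded_linear)
        also have "\<dots> \<le> rho * norm u"
          using assms(9)[OF \<open>xs \<in> level_set (obj f lam r) F0\<close> saddle(1)]
          by (intro mult_right_mono) (simp_all add: spectral_norm_def)
        finally have "norm u * norm (?A *v u) \<le> norm u * (rho * norm u)"
          by (intro mult_left_mono) auto
        then show ?thesis
          using norm_cauchy_schwarz[of u "?A *v u"] by (simp add: power2_eq_square mult_ac)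
      qed
      finally have "bet * (norm u)\<^sup>2 \<le> (alp * rho) * (norm u)\<^sup>2"
        using \<open>0 < alp\<close> by (simp add: mult.assoc)
      moreover have "alp * rho < bet"
        using alp \<open>rho > 0\<close> by (simp add: field_simps)
      ultimately have "norm u = 0"
        by (smt (verit) mult_strict_right_mono zero_less_power2)
      then show ?thesis by (simp add: u zero_prod_def)
    qed
    then have "inj D" using \<open>linear D\<close> by (simp add: linear_injective_0)
    then show ?thesis
      using linear_injective_imp_surjective[OF \<open>linear D\<close>] by (simp add: bij_def)
  qed
  ultimately show ?thesis
    unfolding unstable_fixed_point_def fD by blast
qed

end
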